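(* Let $F=\{F_{\varsigma}\}_{\varsigma\in\mathfrak{A}}$ and $G=\{G_{\varsigma}\}_{\varsigma\in\mathfrak{A}}$ be two continuous frames for $\mathcal{H}$ with frame bounds $A_F\le B_F$ and $A_G\le B_G$ respectively, and suppose that for all families of scalars $\{\alpha_{\varsigma}\}_{\varsigma\in\mathfrak{A}}\in L^2(\mathfrak{A},\mu)$ $$\Big\|\int_{\mathfrak{A}}\alpha_{\varsigma}(F_{\varsigma}-G_{\varsigma})\,d\mu(\varsigma)\Big\|\le a\Big\|\int_{\mathfrak{A}}\alpha_{\varsigma}F_{\varsigma}\,d\mu(\varsigma)\Big\|+b\Big\|\int_{\mathfrak{A}}\alpha_{\varsigma}G_{\varsigma}\,d\mu(\varsigma)\Big\|+c\Big(\int_{\mathfrak{A}}|\alpha_{\varsigma}|^2\,d\mu(\varsigma)\Big)^{1/2}$$ for some positive numbers $a,b,c$ such that $$a\sqrt{B_F}+b\sqrt{B_G}+c<\sqrt{A_F}.$$ Then $F$ and $G$ are continuous woven.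
   Context: $\mathcal{H}$ is a separable Hilbert space and $(\mathfrak{A},\mu)$ a measure space with positive measure $\mu$. All families $\{F_\varsigma\}_{\varsigma\in\mathfrak{A}}\subset\mathcal{H}$ are such that $\varsigma\mapsto\langle f,F_\varsigma\rangle$ is measurable for each $f\in\mathcal{H}$; vector-valued integrals are understood weakly; subsets $K$ of $\mathfrak{A}$ are measurable; $K^C$ is the complement of $K$. A family $F=\{F_\varsigma\}_{\varsigma\in\mathfrak{A}}$ is a continuous frame for $\mathcal{H}$ with frame bounds $0<A_F\le B_F<\infty$ if $A_F\|f\|^2\le\int_{\mathfrak{A}}|\langle f,F_\varsigma\rangle|^2d\mu(\varsigma)\le B_F\|f\|^2$ for all $f\in\mathcal{H}$. Two families $\{F_\varsigma\}$ and $\{G_\varsigma\}$ are continuous woven if there are universal constants $0<A\le B<\infty$ such that for every $K\subset\mathfrak{A}$ the family $\{F_\varsigma\}_{\varsigma\in K}\cup\{G_\varsigma\}_{\varsigma\in K^C}$ is a continuous frame for $\mathcal{H}$ with bounds $A$ and $B$, i.e. $A\|f\|^2\le\int_K|\langle f,F_\varsigma\rangle|^2d\mu(\varsigma)+\int_{K^C}|\langle f,G_\varsigma\rangle|^2d\mu(\varsigma)\le B\|f\|^2$ for all $f\in\mathcal{H}$. *)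

theory Defs
  imports "HOL-Analysis.Analysis"
begin

text \<open>
  The scalar field: the reals or the complex numbers, treated uniformly. The axioms leave no other
  possibility: they make \<open>x * conjugate x\<close> and \<open>x + conjugate x\<close> real, so every scalar has
  degree at most two over the reals.
\<close>

class rc_field = real_normed_field + banach + second_countable_topology +
  fixes conjugate :: "'a \<Rightarrow> 'a"
  assumes conjugate_add: "conjugate (x + y) = conjugate x + conjugate y"
    and conjugate_mult: "conjugate (x * y) = conjugate x * conjugate y"
    and conjugate_conjugate: "conjugate (conjugate x) = x"
    and mult_conjugate_self: "x * conjugate x = (norm x)\<^sup>2 *\<^sub>R 1"

instantiation real :: rc_field
begin
definition conjugate_real :: "real \<Rightarrow> real" where "conjugate_real x = x"
instance
  by standard (simp_all add: conjugate_real_def power2_eq_square)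
end

instantiation complex :: rc_field
begin
definition conjugate_complex :: "complex \<Rightarrow> complex" where "conjugate_complex x = cnj x"
instance
  by standard (simp_all only: conjugate_complex_def complex_cnj_add complex_cnj_mult
      complex_cnj_cnj complex_norm_square scaleR_conv_of_real mult_1_right)
end

text \<open>
  Completeness and separability come from the sorts: a metric space is second countable iff it is
  separable. Positive definiteness of the inner product is contained in \<open>inner_self\<close>. The real
  scalar multiplication that is part of the class \<open>banach\<close> is the restriction of \<open>scale\<close>.
\<close>

locale separable_hilbert_space =
  vector_space scale
  for scale :: "'k::rc_field \<Rightarrow> 'h::{banach, second_countable_topology} \<Rightarrow> 'h" +
  fixes ip :: "'h \<Rightarrow> 'h \<Rightarrow> 'k"
  assumes scale_of_real: "scale (of_real r) x = r *\<^sub>R x"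
    and inner_add_left: "ip (x + y) z = ip x z + ip y z"
    and inner_scale_left: "ip (scale k x) y = k * ip x y"
    and inner_conjugate: "ip y x = conjugate (ip x y)"
    and inner_self: "ip x x = of_real ((norm x)\<^sup>2)"

lemma separable_hilbert_space_real:
  "separable_hilbert_space scaleR
     (inner :: 'h \<Rightarrow> 'h::{real_inner, banach, second_countable_topology} \<Rightarrow> real)"
  by unfold_locales
    (simp_all add: conjugate_real_def inner_commute power2_norm_eq_inner algebra_simps)

lemma separable_hilbert_space_complex:
  "separable_hilbert_space ((*) :: complex \<Rightarrow> complex \<Rightarrow> complex) (\<lambda>x y. x * cnj y)"
  by unfold_locales
    (simp_all add: conjugate_complex_def scaleR_conv_of_real algebra_simps
      flip: complex_norm_square)

definition continuous_frame ::
  "('h \<Rightarrow> 'h \<Rightarrow> 'k::rc_field) \<Rightarrow> 's measure \<Rightarrow>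
    ('s \<Rightarrow> 'h::real_normed_vector) \<Rightarrow> real \<Rightarrow> real \<Rightarrow> bool" where
  "continuous_frame ip M F A B \<longleftrightarrow>
     0 < A \<and> A \<le> B \<and>
     (\<forall>f. (\<lambda>s. ip f (F s)) \<in> borel_measurable M) \<and>
     (\<forall>f. ennreal (A * (norm f)\<^sup>2) \<le> (\<integral>\<^sup>+ s. ennreal ((norm (ip f (F s)))\<^sup>2) \<partial>M) \<and>
          (\<integral>\<^sup>+ s. ennreal ((norm (ip f (F s)))\<^sup>2) \<partial>M) \<le> ennreal (B * (norm f)\<^sup>2))"

text \<open>
  The union of \<open>F\<close> over \<open>K\<close> and \<open>G\<close> over the complement of \<open>K\<close> is, as an indexed family, the
  family that agrees with \<open>F\<close> on \<open>K\<close> and with \<open>G\<close> off \<open>K\<close>.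
\<close>

definition continuous_woven ::
  "('h \<Rightarrow> 'h \<Rightarrow> 'k::rc_field) \<Rightarrow> 's measure \<Rightarrow> ('s \<Rightarrow> 'h::real_normed_vector) \<Rightarrow> ('s \<Rightarrow> 'h) \<Rightarrow> bool" where
  "continuous_woven ip M F G \<longleftrightarrow>
     (\<exists>A B. 0 < A \<and> A \<le> B \<and>
       (\<forall>K \<in> sets M. continuous_frame ip M (\<lambda>s. if s \<in> K then F s else G s) A B))"

definition square_integrable :: "'s measure \<Rightarrow> ('s \<Rightarrow> 'k::rc_field) \<Rightarrow> bool" where
  "square_integrable M \<alpha> \<longleftrightarrow>
     \<alpha> \<in> borel_measurable M \<and> integrable M (\<lambda>s. (norm (\<alpha> s))\<^sup>2)"

definition has_weak_integral ::
  "('h \<Rightarrow> 'h \<Rightarrow> 'k::rc_field) \<Rightarrow> 's measure \<Rightarrow> ('s \<Rightarrow> 'h) \<Rightarrow> 'h \<Rightarrow> bool" where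
  "has_weak_integral ip M H v \<longleftrightarrow>
     (\<forall>f. integrable M (\<lambda>s. ip (H s) f) \<and> ip v f = (\<integral>s. ip (H s) f \<partial>M))"

text \<open>
  Unspecified if no weak integral exists. For \<open>H s = scale (\<alpha> s) (F s)\<close> with \<open>\<alpha>\<close> square integrable
  and \<open>F\<close> a continuous frame, existence is the Riesz representation theorem.
\<close>

definition weak_integral ::
  "('h \<Rightarrow> 'h \<Rightarrow> 'k::rc_field) \<Rightarrow> 's measure \<Rightarrow> ('s \<Rightarrow> 'h) \<Rightarrow> 'h" where
  "weak_integral ip M H = (THE v. has_weak_integral ip M H v)"

end

theory Submission imports Defs begin

text \<open>
  Write \<open>V\<^sub>F f = (\<lambda>s. \<langle>f, F s\<rangle>)\<close> for the analysis operator of \<open>F\<close>, with values in \<open>L\<^sup>2\<close>, and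
  \<open>T\<^sub>F \<alpha> = \<integral> \<alpha> F\<close> for its adjoint, the synthesis operator. The frame inequalities say
  \<open>\<surd>A\<^sub>F * \<parallel>f\<parallel> \<le> \<parallel>V\<^sub>F f\<parallel> \<le> \<surd>B\<^sub>F * \<parallel>f\<parallel>\<close>, and by duality \<open>\<parallel>T\<^sub>F\<parallel> \<le> \<surd>B\<^sub>F\<close>. Hence the
  perturbation hypothesis bounds \<open>T\<^sub>F - T\<^sub>G\<close> by \<open>\<lambda> = a * \<surd>B\<^sub>F + b * \<surd>B\<^sub>G + c\<close>, and, by duality
  again, the same \<open>\<lambda>\<close> bounds \<open>V\<^sub>F - V\<^sub>G\<close>.

  The family woven along \<open>K\<close> has the analysis operator \<open>U f = V\<^sub>F f - 1\<^bsub>K\<^sup>C\<^esub> (V\<^sub>F f - V\<^sub>G f)\<close>.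
  Cutting off with an indicator does not increase an \<open>L\<^sup>2\<close> norm, so
  \<open>\<parallel>U f\<parallel> \<ge> (\<surd>A\<^sub>F - \<lambda>) * \<parallel>f\<parallel>\<close> with a constant independent of \<open>K\<close>. This gives the universal
  lower bound \<open>(\<surd>A\<^sub>F - \<lambda>)\<^sup>2\<close>; the upper bound \<open>B\<^sub>F + B\<^sub>G\<close> is immediate.

  Both duality arguments are elementary once the weak integrals \<open>T\<^sub>F \<alpha>\<close> are known to exist. That
  is the Riesz representation theorem (\<open>riesz_representation\<close>), proved below for the real and the
  complex scalars at once; \<open>weak_integral_synthesis\<close> and \<open>l2_norm_analysis_le\<close> are the two
  halves of the duality.
\<close>

section \<open>Conjugation of scalars\<close>

lemma conjugate_zero [simp]: "conjugate (0::'k::rc_field) = 0"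
  using conjugate_add[of "0::'k" 0] by simp

lemma norm_conjugate [simp]: "norm (conjugate x) = norm (x::'k::rc_field)"
proof (cases "x = 0")
  case False
  have "norm (x * conjugate x) = norm ((norm x)\<^sup>2 *\<^sub>R (1::'k))"
    by (simp only: mult_conjugate_self)
  then show ?thesis using False by (simp add: norm_mult power2_eq_square)
qed simp

lemma conjugate_eq_zero_iff [simp]: "conjugate x = 0 \<longleftrightarrow> x = (0::'k::rc_field)"
  by (metis norm_conjugate norm_eq_zero)

lemma conjugate_of_real [simp]: "conjugate (of_real r :: 'k::rc_field) = of_real r"
proof (cases "r = 0")
  case False
  have "of_real r * conjugate (of_real r :: 'k) = of_real r * of_real r"
    by (simp add: mult_conjugate_self scaleR_conv_of_real power2_eq_square flip: of_real_mult)
  then show ?thesis using False by simp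
qed simp

lemma mult_conjugate: "x * conjugate (x::'k::rc_field) = of_real ((norm x)\<^sup>2)"
  by (simp add: mult_conjugate_self scaleR_conv_of_real)

lemma bounded_linear_conjugate: "bounded_linear (conjugate :: 'k::rc_field \<Rightarrow> 'k)"
proof
  fix x y :: 'k and r :: real
  show "conjugate (x + y) = conjugate x + conjugate y"
    by (rule conjugate_add)
  show "conjugate (r *\<^sub>R x) = r *\<^sub>R conjugate x"
    by (simp add: scaleR_conv_of_real conjugate_mult)
  show "\<exists>K. \<forall>x::'k. norm (conjugate x) \<le> norm x * K"
    by (rule exI[of _ 1]) simp
qed

lemma borel_measurable_conjugate [measurable]:
  "(conjugate :: 'k::rc_field \<Rightarrow> 'k) \<in> borel_measurable borel"
  by (intro borel_measurable_continuous_onI linear_continuous_on bounded_linear_conjugate)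

section \<open>Square-integrable functions\<close>

definition l2_norm :: "'s measure \<Rightarrow> ('s \<Rightarrow> 'k::rc_field) \<Rightarrow> real" where
  "l2_norm M \<alpha> = sqrt (\<integral>s. (norm (\<alpha> s))\<^sup>2 \<partial>M)"

lemma l2_norm_nonneg [simp]: "0 \<le> l2_norm M \<alpha>"
  by (simp add: l2_norm_def)

lemma l2_norm_power2: "(l2_norm M \<alpha>)\<^sup>2 = (\<integral>s. (norm (\<alpha> s))\<^sup>2 \<partial>M)"
  by (simp add: l2_norm_def)

lemma square_integrable_measurable:
  "square_integrable M \<alpha> \<Longrightarrow> \<alpha> \<in> borel_measurable M"
  by (simp add: square_integrable_def)

lemma square_integrable_mono:
  assumes "square_integrable M \<beta>" "\<alpha> \<in> borel_measurable M" "\<And>s. norm (\<alpha> s) \<le> norm (\<beta> s)"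
  shows "square_integrable M \<alpha>" and "l2_norm M \<alpha> \<le> l2_norm M \<beta>"
proof -
  have int: "integrable M (\<lambda>s. (norm (\<beta> s))\<^sup>2)"
    using assms(1) by (simp add: square_integrable_def)
  have le: "(norm (\<alpha> s))\<^sup>2 \<le> (norm (\<beta> s))\<^sup>2" for s
    by (intro power_mono assms(3) norm_ge_zero)
  have int': "integrable M (\<lambda>s. (norm (\<alpha> s))\<^sup>2)"
    by (rule Bochner_Integration.integrable_bound[OF int]) (use assms(2) le in auto)
  then show "square_integrable M \<alpha>"
    using assms(2) by (simp add: square_integrable_def)
  show "l2_norm M \<alpha> \<le> l2_norm M \<beta>"
    unfolding l2_norm_def by (intro real_sqrt_le_mono integral_mono int int' le)
qed

lemma l2_Cauchy_Schwarz:
  assumes \<alpha>: "square_integrable M \<alpha>" and \<beta>: "square_integrable M \<beta>"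
  shows "integrable M (\<lambda>s. norm (\<alpha> s) * norm (\<beta> s))"
    and "(\<integral>s. norm (\<alpha> s) * norm (\<beta> s) \<partial>M) \<le> l2_norm M \<alpha> * l2_norm M \<beta>"
proof -
  have [measurable]: "\<alpha> \<in> borel_measurable M" "\<beta> \<in> borel_measurable M"
    using \<alpha> \<beta> by (simp_all add: square_integrable_def)
  have int\<alpha>: "integrable M (\<lambda>s. (norm (\<alpha> s))\<^sup>2)" and int\<beta>: "integrable M (\<lambda>s. (norm (\<beta> s))\<^sup>2)"
    using \<alpha> \<beta> by (simp_all add: square_integrable_def)
  have le: "x * y \<le> x\<^sup>2 + y\<^sup>2" if "0 \<le> x" "0 \<le> y" for x y :: real
    using sum_squares_bound[of x y] mult_nonneg_nonneg[OF that] by linarith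
  show int: "integrable M (\<lambda>s. norm (\<alpha> s) * norm (\<beta> s))"
    by (rule Bochner_Integration.integrable_bound[OF Bochner_Integration.integrable_add[OF int\<alpha> int\<beta>]])
      (auto simp: le)
  let ?I = "\<integral>s. norm (\<alpha> s) * norm (\<beta> s) \<partial>M"
  have "(\<integral>\<^sup>+ s. ennreal (norm (\<alpha> s)) * ennreal (norm (\<beta> s)) \<partial>M)\<^sup>2
      \<le> (\<integral>\<^sup>+ s. (ennreal (norm (\<alpha> s)))\<^sup>2 \<partial>M) * (\<integral>\<^sup>+ s. (ennreal (norm (\<beta> s)))\<^sup>2 \<partial>M)"
    by (rule Cauchy_Schwarz_nn_integral) auto
  then have "(ennreal ?I)\<^sup>2 \<le> ennreal ((l2_norm M \<alpha>)\<^sup>2) * ennreal ((l2_norm M \<beta>)\<^sup>2)"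
    using nn_integral_eq_integral[OF int] nn_integral_eq_integral[OF int\<alpha>]
      nn_integral_eq_integral[OF int\<beta>]
    by (simp add: ennreal_mult ennreal_power l2_norm_power2)
  then have "?I\<^sup>2 \<le> (l2_norm M \<alpha> * l2_norm M \<beta>)\<^sup>2"
    by (simp add: ennreal_power power_mult_distrib flip: ennreal_mult)
  then show "?I \<le> l2_norm M \<alpha> * l2_norm M \<beta>"
    by (rule power2_le_imp_le) simp
qed

lemma l2_Minkowski:
  assumes \<alpha>: "square_integrable M \<alpha>" and \<beta>: "square_integrable M \<beta>"
  shows "square_integrable M (\<lambda>s. \<alpha> s + \<beta> s)"
    and "l2_norm M (\<lambda>s. \<alpha> s + \<beta> s) \<le> l2_norm M \<alpha> + l2_norm M \<beta>"
proof -
  have [measurable]: "\<alpha> \<in> borel_measurable M" "\<beta> \<in> borel_measurable M"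
    using \<alpha> \<beta> by (simp_all add: square_integrable_def)
  have int\<alpha>: "integrable M (\<lambda>s. (norm (\<alpha> s))\<^sup>2)" and int\<beta>: "integrable M (\<lambda>s. (norm (\<beta> s))\<^sup>2)"
    using \<alpha> \<beta> by (simp_all add: square_integrable_def)
  note int\<alpha>\<beta> = l2_Cauchy_Schwarz(1)[OF \<alpha> \<beta>]
  let ?g = "\<lambda>s. (norm (\<alpha> s))\<^sup>2 + 2 * (norm (\<alpha> s) * norm (\<beta> s)) + (norm (\<beta> s))\<^sup>2"
  have intg: "integrable M ?g"
    by (intro Bochner_Integration.integrable_add integrable_mult_right int\<alpha> int\<beta> int\<alpha>\<beta>)
  have le: "(norm (\<alpha> s + \<beta> s))\<^sup>2 \<le> ?g s" for s
    using power_mono[OF norm_triangle_ineq[of "\<alpha> s" "\<beta> s"], of 2]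
    by (simp add: power2_sum)
  have int: "integrable M (\<lambda>s. (norm (\<alpha> s + \<beta> s))\<^sup>2)"
  proof (rule Bochner_Integration.integrable_bound[OF intg])
    have "norm ((norm (\<alpha> s + \<beta> s))\<^sup>2) \<le> norm (?g s)" for s
      unfolding real_norm_def abs_power2 using le[of s] abs_ge_self[of "?g s"] by linarith
    then show "AE s in M. norm ((norm (\<alpha> s + \<beta> s))\<^sup>2) \<le> norm (?g s)" by simp
  qed measurable
  then show "square_integrable M (\<lambda>s. \<alpha> s + \<beta> s)"
    by (simp add: square_integrable_def)
  have "(l2_norm M (\<lambda>s. \<alpha> s + \<beta> s))\<^sup>2 \<le> (\<integral>s. ?g s \<partial>M)"
    unfolding l2_norm_power2 by (intro integral_mono int intg le)
  also have "\<dots> = (l2_norm M \<alpha>)\<^sup>2 + 2 * (\<integral>s. norm (\<alpha> s) * norm (\<beta> s) \<partial>M) + (l2_norm M \<beta>)\<^sup>2"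
    using int\<alpha> int\<beta> int\<alpha>\<beta> by (simp add: l2_norm_power2)
  also have "\<dots> \<le> (l2_norm M \<alpha> + l2_norm M \<beta>)\<^sup>2"
    using l2_Cauchy_Schwarz(2)[OF \<alpha> \<beta>] by (simp add: power2_sum)
  finally show "l2_norm M (\<lambda>s. \<alpha> s + \<beta> s) \<le> l2_norm M \<alpha> + l2_norm M \<beta>"
    by (rule power2_le_imp_le) simp
qed

lemma square_integrable_uminus: "square_integrable M \<alpha> \<Longrightarrow> square_integrable M (\<lambda>s. - \<alpha> s)"
  by (simp add: square_integrable_def)

lemma square_integrable_diff:
  "square_integrable M \<alpha> \<Longrightarrow> square_integrable M \<beta> \<Longrightarrow> square_integrable M (\<lambda>s. \<alpha> s - \<beta> s)"
  using l2_Minkowski(1)[of M \<alpha> "\<lambda>s. - \<beta> s"] by (simp add: square_integrable_uminus)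

text \<open>
  An integral that is infinite in the extended sense would have the value zero as a real number,
  hence the explicit square integrability on the right-hand side.
\<close>

lemma continuous_frame_iff_l2:
  "continuous_frame ip M F A B \<longleftrightarrow> 0 < A \<and> A \<le> B \<and>
     (\<forall>f. square_integrable M (\<lambda>s. ip f (F s)) \<and>
       sqrt A * norm f \<le> l2_norm M (\<lambda>s. ip f (F s)) \<and>
       l2_norm M (\<lambda>s. ip f (F s)) \<le> sqrt B * norm f)"
proof (cases "0 < A \<and> A \<le> B")
  case True
  then have A: "0 \<le> A" and B: "0 \<le> B" by auto
  let ?V = "\<lambda>f s. ip f (F s)"
  let ?N = "\<lambda>f. \<integral>\<^sup>+ s. ennreal ((norm (?V f s))\<^sup>2) \<partial>M"
  have nn: "?N f = ennreal ((l2_norm M (?V f))\<^sup>2)" if "square_integrable M (?V f)" for f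
    unfolding l2_norm_power2
    using that by (intro nn_integral_eq_integral) (simp_all add: square_integrable_def)
  have sq: "square_integrable M (?V f)"
    if m: "?V f \<in> borel_measurable M" and "?N f \<le> ennreal (B * (norm f)\<^sup>2)" for f
  proof -
    have "?N f < \<infinity>"
      using that(2) by (rule le_less_trans) simp
    then show ?thesis
      using m by (auto simp: square_integrable_def integrable_iff_bounded)
  qed
  have lower: "A * (norm f)\<^sup>2 \<le> x\<^sup>2 \<longleftrightarrow> sqrt A * norm f \<le> x"
    if "0 \<le> x" for f and x :: real
  proof -
    have "A * (norm f)\<^sup>2 = (sqrt A * norm f)\<^sup>2" using A by (simp add: power_mult_distrib)
    then show ?thesis using that A by (simp add: power2_le_iff_abs_le abs_mult)
  qed
  have upper: "ennreal (x\<^sup>2) \<le> ennreal (B * (norm f)\<^sup>2) \<longleftrightarrow> x \<le> sqrt B * norm f"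
    if "0 \<le> x" for f and x :: real
  proof -
    have "B * (norm f)\<^sup>2 = (sqrt B * norm f)\<^sup>2" using B by (simp add: power_mult_distrib)
    then show ?thesis using that B by (simp add: power2_le_iff_abs_le)
  qed
  have "(?V f \<in> borel_measurable M \<and> ennreal (A * (norm f)\<^sup>2) \<le> ?N f \<and>
         ?N f \<le> ennreal (B * (norm f)\<^sup>2)) \<longleftrightarrow>
       (square_integrable M (?V f) \<and> sqrt A * norm f \<le> l2_norm M (?V f) \<and>
         l2_norm M (?V f) \<le> sqrt B * norm f)" for f
  proof (cases "square_integrable M (?V f)")
    case True
    then show ?thesis
      by (simp add: nn lower upper square_integrable_measurable)
  next
    case False
    then show ?thesis using sq by blast
  qed
  then show ?thesis unfolding continuous_frame_def by blast
qed (auto simp: continuous_frame_def)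

section \<open>Hilbert space geometry and the Riesz representation theorem\<close>

context separable_hilbert_space
begin

lemma ip_zero_left [simp]: "ip 0 y = 0"
  using inner_add_left[of 0 0 y] by simp

lemma ip_minus_left: "ip (- x) y = - ip x y"
  using inner_add_left[of x "- x" y] by (simp add: eq_neg_iff_add_eq_0 add.commute)

lemma ip_diff_left: "ip (x - y) z = ip x z - ip y z"
  using inner_add_left[of x "- y" z] by (simp add: ip_minus_left)

lemma ip_add_right: "ip x (y + z) = ip x y + ip x z"
  by (subst (1 2 3) inner_conjugate) (simp add: inner_add_left conjugate_add)

lemma ip_zero_right [simp]: "ip x 0 = 0"
  using ip_add_right[of x 0 0] by simp

lemma ip_minus_right: "ip x (- y) = - ip x y"
  using ip_add_right[of x y "- y"] by (simp add: eq_neg_iff_add_eq_0 add.commute)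

lemma ip_diff_right: "ip x (y - z) = ip x y - ip x z"
  using ip_add_right[of x y "- z"] by (simp add: ip_minus_right)

lemma ip_scale_right: "ip x (scale k y) = conjugate k * ip x y"
  by (subst (1 2) inner_conjugate) (simp add: inner_scale_left conjugate_mult)

text \<open>
  Nonnegativity of the left-hand side is the Cauchy-Schwarz inequality; strict decrease of the norm
  is what forces a vector of least norm to be orthogonal to the admissible directions.
\<close>

lemma norm_sq_sub_projection:
  assumes "y \<noteq> 0"
  shows "(norm (x - scale (ip x y / of_real ((norm y)\<^sup>2)) y))\<^sup>2
    = (norm x)\<^sup>2 - (norm (ip x y))\<^sup>2 / (norm y)\<^sup>2"
proof -
  let ?n = "of_real ((norm y)\<^sup>2) :: 'k"
  define t where "t = ip x y / ?n"
  have n: "?n \<noteq> 0" using assms by simp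
  have tn: "t * ?n = ip x y" using n by (simp add: t_def)
  have yx: "ip y x = conjugate (ip x y)" by (rule inner_conjugate)
  have "ip (x - scale t y) (x - scale t y)
      = ip x x - conjugate t * ip x y - t * conjugate (ip x y) + t * conjugate t * ?n"
    by (simp only: ip_diff_left ip_diff_right inner_scale_left ip_scale_right inner_self[of y] yx)
      (simp add: algebra_simps)
  also have "t * conjugate t * ?n = conjugate t * ip x y"
    using tn by (metis mult.assoc mult.commute)
  also have "ip x x - conjugate t * ip x y - t * conjugate (ip x y) + conjugate t * ip x y
      = ip x x - (ip x y * conjugate (ip x y)) / ?n"
    by (simp add: t_def)
  also have "\<dots> = of_real ((norm x)\<^sup>2 - (norm (ip x y))\<^sup>2 / (norm y)\<^sup>2)"
    by (simp only: inner_self mult_conjugate of_real_diff of_real_divide)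
  finally have "of_real ((norm (x - scale t y))\<^sup>2)
      = (of_real ((norm x)\<^sup>2 - (norm (ip x y))\<^sup>2 / (norm y)\<^sup>2) :: 'k)"
    by (simp only: inner_self)
  then show ?thesis by (simp only: of_real_eq_iff t_def)
qed

lemma ip_Cauchy_Schwarz: "norm (ip x y) \<le> norm x * norm y"
proof (cases "y = 0")
  case False
  then have "(norm (ip x y))\<^sup>2 / (norm y)\<^sup>2 \<le> (norm x)\<^sup>2"
    using norm_sq_sub_projection[OF False, of x]
    by (smt (verit) zero_le_power2)
  then have "(norm (ip x y))\<^sup>2 \<le> (norm x * norm y)\<^sup>2"
    using False by (simp add: divide_le_eq power_mult_distrib)
  then show ?thesis by (rule power2_le_imp_le) simp
qed simp

lemma ip_parallelogram:
  fixes x y :: 'h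
  shows "(norm (x + y))\<^sup>2 + (norm (x - y))\<^sup>2 = 2 * (norm x)\<^sup>2 + 2 * (norm y)\<^sup>2"
proof -
  have "ip (x + y) (x + y) + ip (x - y) (x - y) = 2 * ip x x + 2 * ip y y"
    by (simp only: inner_add_left ip_add_right ip_diff_left ip_diff_right)
      (simp add: algebra_simps)
  then have "of_real ((norm (x + y))\<^sup>2 + (norm (x - y))\<^sup>2)
      = (of_real (2 * (norm x)\<^sup>2 + 2 * (norm y)\<^sup>2) :: 'k)"
    by (simp only: inner_self of_real_add of_real_mult of_real_numeral)
  then show ?thesis by (simp only: of_real_eq_iff)
qed

text \<open>
  The parallelogram law applied to two points of a closed convex set whose norms are close to the infimum
  bounds their distance, because the midpoint has norm at least the infimum. So minimizing
  sequences are Cauchy.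
\<close>

lemma closed_convex_min_norm:
  assumes "closed S" "S \<noteq> {}" and mid: "\<And>x y. x \<in> S \<Longrightarrow> y \<in> S \<Longrightarrow> (1/2) *\<^sub>R (x + y) \<in> S"
  obtains u :: 'h where "u \<in> S" "\<And>x. x \<in> S \<Longrightarrow> norm u \<le> norm x"
proof -
  define d where "d = (INF x\<in>S. (norm x)\<^sup>2)"
  have bdd: "bdd_below ((\<lambda>x. (norm x)\<^sup>2) ` S)"
    by (rule bdd_belowI[of _ 0]) auto
  have d_le: "d \<le> (norm x)\<^sup>2" if "x \<in> S" for x
    unfolding d_def by (rule cINF_lower[OF bdd that])
  have "\<exists>x\<in>S. (norm x)\<^sup>2 < d + e" if "0 < e" for e
    using cINF_less_iff[OF assms(2) bdd, of "d + e"] that by (simp add: d_def)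
  then have "\<forall>n. \<exists>x. x \<in> S \<and> (norm x)\<^sup>2 < d + 1 / real (Suc n)"
    by (metis of_nat_0_less_iff zero_less_Suc zero_less_divide_1_iff)
  then obtain X where X: "\<And>n. X n \<in> S" "\<And>n. (norm (X n))\<^sup>2 < d + 1 / real (Suc n)"
    by metis
  have dist: "(norm (X m - X n))\<^sup>2 < 2 / real (Suc m) + 2 / real (Suc n)" for m n
  proof -
    have "d \<le> (norm ((1/2) *\<^sub>R (X m + X n)))\<^sup>2"
      by (intro d_le mid X)
    then have "4 * d \<le> (norm (X m + X n))\<^sup>2"
      by (simp add: power_mult_distrib power_divide)
    then show ?thesis
      using ip_parallelogram[of "X m" "X n"] X(2)[of m] X(2)[of n] by simp
  qed
  have "Cauchy X"
  proof (rule CauchyI)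
    fix e :: real assume e: "0 < e"
    obtain N where N: "4 / e\<^sup>2 < real N" using reals_Archimedean2 by blast
    have "norm (X m - X n) < e" if "N \<le> m" "N \<le> n" for m n
    proof -
      have "0 < real N" using N e by (smt (verit) divide_pos_pos zero_less_power)
      then have "1 / real (Suc m) \<le> 1 / real N" "1 / real (Suc n) \<le> 1 / real N"
        using that by (auto intro!: divide_left_mono)
      then have "2 / real (Suc m) + 2 / real (Suc n) \<le> 4 / real N"
        by simp
      also have "\<dots> < e\<^sup>2" using N e \<open>0 < real N\<close> by (simp add: field_simps)
      finally show ?thesis
        using dist[of m n] e by (intro power2_less_imp_less[of _ e]) auto
    qed
    then show "\<exists>M. \<forall>m\<ge>M. \<forall>n\<ge>M. norm (X m - X n) < e" by blast
  qed
  then obtain u where u: "X \<longlonglongrightarrow> u" by (auto simp: Cauchy_convergent_iff convergent_def)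
  have "u \<in> S" using closed_sequentially[OF assms(1)] X(1) u by blast
  moreover have "norm u \<le> norm x" if "x \<in> S" for x
  proof -
    have "(\<lambda>n. (norm (X n))\<^sup>2) \<longlonglongrightarrow> (norm u)\<^sup>2"
      by (intro tendsto_intros u)
    moreover have "(\<lambda>n. d + 1 / real (Suc n)) \<longlonglongrightarrow> d + 0"
      by (intro tendsto_intros LIMSEQ_Suc[OF lim_1_over_n])
    ultimately have "(norm u)\<^sup>2 \<le> d + 0"
      by (rule LIMSEQ_le) (use X(2) less_imp_le in blast)
    then have "(norm u)\<^sup>2 \<le> (norm x)\<^sup>2" using d_le[OF that] by linarith
    then show ?thesis by (rule power2_le_imp_le) simp
  qed
  ultimately show ?thesis using that by blast
qed

text \<open>
  The point \<open>u\<close> of least norm on the hyperplane \<open>\<phi> = 1\<close> is orthogonal to the kernel of \<open>\<phi>\<close>, so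
  \<open>\<phi>\<close> is a multiple of the inner product with \<open>u\<close>.
\<close>

lemma riesz_representation:
  assumes add: "\<And>x y. \<phi> (x + y) = \<phi> x + \<phi> y"
    and scale: "\<And>k x. \<phi> (scale k x) = k * \<phi> x"
    and bound: "\<And>x. norm (\<phi> x) \<le> C * norm x" and "0 \<le> C"
  obtains v where "\<And>x. \<phi> x = ip x v" "norm v \<le> C"
proof -
  have "\<exists>v. \<forall>x. \<phi> x = ip x v"
  proof (cases "\<forall>x. \<phi> x = 0")
    case True
    then show ?thesis by (intro exI[of _ 0]) simp
  next
    case False
    then obtain x0 where x0: "\<phi> x0 \<noteq> 0" by blast
    have scaleR: "\<phi> (r *\<^sub>R x) = r *\<^sub>R \<phi> x" for r x
      using scale[of "of_real r" x] by (simp add: scale_of_real scaleR_conv_of_real)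
    have bl: "bounded_linear \<phi>"
      by (rule bounded_linear_intro[of _ C])
        (use add scaleR bound in \<open>auto simp: mult.commute\<close>)
    interpret \<phi>: bounded_linear \<phi> by (rule bl)
    define S where "S = \<phi> -` {1}"
    have "closed S"
      unfolding S_def
      by (intro closed_vimage closed_singleton linear_continuous_on bl)
    moreover have "S \<noteq> {}"
    proof -
      have "scale (inverse (\<phi> x0)) x0 \<in> S" using x0 by (simp add: S_def scale)
      then show ?thesis by blast
    qed
    moreover have "(1/2) *\<^sub>R (x + y) \<in> S" if "x \<in> S" "y \<in> S" for x y
      using that by (simp add: S_def \<phi>.scaleR \<phi>.add flip: scaleR_2)
    ultimately obtain u where u: "u \<in> S" and min: "\<And>x. x \<in> S \<Longrightarrow> norm u \<le> norm x"
      using closed_convex_min_norm by blast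
    have "\<phi> u = 1" using u by (simp add: S_def)
    then have "u \<noteq> 0" using \<phi>.zero by auto
    have orth: "ip z u = 0" if "\<phi> z = 0" for z
    proof (rule ccontr)
      assume "ip z u \<noteq> 0"
      then have uz: "ip u z \<noteq> 0"
        using inner_conjugate[of u z] by auto
      then have "z \<noteq> 0" by auto
      let ?w = "u - scale (ip u z / of_real ((norm z)\<^sup>2)) z"
      have "?w \<in> S" using \<open>\<phi> u = 1\<close> that by (simp add: S_def \<phi>.diff scale)
      then have "(norm u)\<^sup>2 \<le> (norm ?w)\<^sup>2" by (intro power_mono min) auto
      moreover have "0 < (norm (ip u z))\<^sup>2 / (norm z)\<^sup>2" using uz \<open>z \<noteq> 0\<close> by simp
      ultimately show False unfolding norm_sq_sub_projection[OF \<open>z \<noteq> 0\<close>] by linarith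
    qed
    have "\<phi> x = ip x (scale (of_real (inverse ((norm u)\<^sup>2))) u)" for x
    proof -
      have "ip (x - scale (\<phi> x) u) u = 0"
        by (rule orth) (simp add: \<phi>.diff scale \<open>\<phi> u = 1\<close>)
      then have "ip x u = \<phi> x * of_real ((norm u)\<^sup>2)"
        by (simp only: ip_diff_left inner_scale_left inner_self) simp
      then show ?thesis
        using \<open>u \<noteq> 0\<close> by (simp only: ip_scale_right conjugate_of_real) simp
    qed
    then show ?thesis by blast
  qed
  then obtain v where v: "\<And>x. \<phi> x = ip x v" by blast
  have "norm (ip v v) \<le> C * norm v" using bound[of v] v by simp
  then have "norm v * norm v \<le> C * norm v"
    by (simp add: inner_self power2_eq_square norm_mult)
  then have "norm v \<le> C"
    using \<open>0 \<le> C\<close> by (cases "v = 0") auto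
  with v show ?thesis using that by blast
qed

section \<open>Duality of analysis and synthesis\<close>

lemma ip_left_eqI: "(\<And>f. ip v f = ip w f) \<Longrightarrow> v = w"
  using inner_self[of "v - w"] by (simp add: ip_diff_left)

lemma weak_integral_eqI: "has_weak_integral ip M H v \<Longrightarrow> weak_integral ip M H = v"
  unfolding weak_integral_def has_weak_integral_def
  by (rule the_equality) (auto intro: ip_left_eqI)

lemma has_weak_integral_diff:
  assumes "has_weak_integral ip M H v" "has_weak_integral ip M H' v'"
  shows "has_weak_integral ip M (\<lambda>s. H s - H' s) (v - v')"
  using assms by (simp add: has_weak_integral_def ip_diff_left)

text \<open>
  Synthesis is the adjoint of analysis: by the Cauchy-Schwarz inequality in \<open>L\<^sup>2\<close>, pairing the
  analysis coefficients of \<open>f\<close> with \<open>\<alpha>\<close> is a functional of norm at most \<open>C * \<parallel>\<alpha>\<parallel>\<close> in \<open>f\<close>, and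
  the vector representing it is the weak integral.
\<close>

lemma weak_integral_synthesis:
  assumes F: "\<And>f. square_integrable M (\<lambda>s. ip f (F s))"
    and bound: "\<And>f. l2_norm M (\<lambda>s. ip f (F s)) \<le> C * norm f" and "0 \<le> C"
    and \<alpha>: "square_integrable M \<alpha>"
  shows "has_weak_integral ip M (\<lambda>s. scale (\<alpha> s) (F s)) (weak_integral ip M (\<lambda>s. scale (\<alpha> s) (F s)))"
    and "norm (weak_integral ip M (\<lambda>s. scale (\<alpha> s) (F s))) \<le> C * l2_norm M \<alpha>"
proof -
  have [measurable]: "\<alpha> \<in> borel_measurable M" "\<And>f. (\<lambda>s. ip f (F s)) \<in> borel_measurable M"
    using \<alpha> F by (simp_all add: square_integrable_def)
  define \<phi> where "\<phi> f = (\<integral>s. conjugate (\<alpha> s) * ip f (F s) \<partial>M)" for f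
  have int: "integrable M (\<lambda>s. conjugate (\<alpha> s) * ip f (F s))" for f
    by (rule Bochner_Integration.integrable_bound[OF l2_Cauchy_Schwarz(1)[OF \<alpha> F[of f]]])
      (auto simp: norm_mult)
  have "norm (\<phi> f) \<le> (C * l2_norm M \<alpha>) * norm f" for f
  proof -
    have "norm (\<phi> f) \<le> (\<integral>s. norm (conjugate (\<alpha> s) * ip f (F s)) \<partial>M)"
      unfolding \<phi>_def by (rule integral_norm_bound)
    also have "\<dots> = (\<integral>s. norm (\<alpha> s) * norm (ip f (F s)) \<partial>M)"
      by (simp add: norm_mult)
    also have "\<dots> \<le> l2_norm M \<alpha> * l2_norm M (\<lambda>s. ip f (F s))"
      by (rule l2_Cauchy_Schwarz(2)[OF \<alpha> F])
    also have "\<dots> \<le> l2_norm M \<alpha> * (C * norm f)"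
      by (intro mult_left_mono bound) simp
    finally show ?thesis by (simp add: algebra_simps)
  qed
  moreover have "\<phi> (x + y) = \<phi> x + \<phi> y" for x y
    using int[of x] int[of y] by (simp add: \<phi>_def inner_add_left distrib_left)
  moreover have "\<phi> (scale k x) = k * \<phi> x" for k x
    unfolding \<phi>_def inner_scale_left mult.left_commute[of _ k] by simp
  moreover have "0 \<le> C * l2_norm M \<alpha>" using \<open>0 \<le> C\<close> by simp
  ultimately obtain v where v: "\<And>x. \<phi> x = ip x v" "norm v \<le> C * l2_norm M \<alpha>"
    using riesz_representation[of \<phi>] by metis
  \<comment> \<open>\<open>\<phi>\<close> is linear in \<open>f\<close>, whereas the weak integral pairs with \<open>f\<close> in the second,
    conjugate-linear argument.\<close>
  have eq: "ip (scale (\<alpha> s) (F s)) f = conjugate (conjugate (\<alpha> s) * ip f (F s))" for s f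
    unfolding conjugate_mult conjugate_conjugate inner_scale_left
    by (simp only: inner_conjugate[of "F s" f])
  have "has_weak_integral ip M (\<lambda>s. scale (\<alpha> s) (F s)) v"
    unfolding has_weak_integral_def eq inner_conjugate[of v] v(1)[symmetric]
  proof (intro allI conjI)
    fix f
    show "integrable M (\<lambda>s. conjugate (conjugate (\<alpha> s) * ip f (F s)))"
      by (rule integrable_bounded_linear[OF bounded_linear_conjugate int])
    show "conjugate (\<phi> f) = (\<integral>s. conjugate (conjugate (\<alpha> s) * ip f (F s)) \<partial>M)"
      unfolding \<phi>_def by (rule integral_bounded_linear[OF bounded_linear_conjugate int, symmetric])
  qed
  with v(2) show "has_weak_integral ip M (\<lambda>s. scale (\<alpha> s) (F s)) (weak_integral ip M (\<lambda>s. scale (\<alpha> s) (F s)))"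
    and "norm (weak_integral ip M (\<lambda>s. scale (\<alpha> s) (F s))) \<le> C * l2_norm M \<alpha>"
    by (simp_all add: weak_integral_eqI)
qed

text \<open>
  Test the synthesis bound on the analysis coefficients \<open>\<alpha> = \<langle>f, H s\<rangle>\<close> themselves: then
  \<open>\<parallel>\<alpha>\<parallel>\<^sup>2 = \<langle>v, f\<rangle> \<le> \<parallel>v\<parallel> * \<parallel>f\<parallel>\<close> for the weak integral \<open>v\<close>, and one factor \<open>\<parallel>\<alpha>\<parallel>\<close> cancels.
\<close>

lemma l2_norm_analysis_le:
  assumes sq: "square_integrable M (\<lambda>s. ip f (H s))"
    and v: "has_weak_integral ip M (\<lambda>s. scale (ip f (H s)) (H s)) v"
    and bound: "norm v \<le> C * l2_norm M (\<lambda>s. ip f (H s))" and "0 \<le> C"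
  shows "l2_norm M (\<lambda>s. ip f (H s)) \<le> C * norm f"
proof -
  let ?L = "l2_norm M (\<lambda>s. ip f (H s))"
  have "ip (scale (ip f (H s)) (H s)) f = of_real ((norm (ip f (H s)))\<^sup>2)" for s
    by (simp only: inner_scale_left inner_conjugate[of "H s" f] mult_conjugate)
  moreover have int: "(\<integral>s. of_real ((norm (ip f (H s)))\<^sup>2) \<partial>M)
      = (of_real (\<integral>s. (norm (ip f (H s)))\<^sup>2 \<partial>M) :: 'k)"
    by (rule integral_bounded_linear[OF bounded_linear_of_real])
      (use sq in \<open>simp add: square_integrable_def\<close>)
  ultimately have "ip v f = of_real (?L\<^sup>2)"
    using v int by (simp only: has_weak_integral_def l2_norm_power2)
  then have "?L\<^sup>2 = norm (ip v f)" by (simp add: norm_power)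
  also have "\<dots> \<le> norm v * norm f" by (rule ip_Cauchy_Schwarz)
  also have "\<dots> \<le> C * ?L * norm f" by (intro mult_right_mono bound) simp
  finally have "?L * ?L \<le> (C * norm f) * ?L" by (simp add: power2_eq_square algebra_simps)
  then show ?thesis
    using \<open>0 \<le> C\<close> l2_norm_nonneg[of M "\<lambda>s. ip f (H s)"]
    by (cases "?L = 0") auto
qed

end

section \<open>Perturbations of frames are woven\<close>

text \<open>
  The gap between \<open>D\<close> and \<open>\<surd>A\<close> survives every weaving, because off \<open>K\<close> the woven
  coefficients differ from those of \<open>F\<close> by a truncation of \<open>V\<^sub>F f - V\<^sub>G f\<close>.
\<close>

lemma continuous_woven_of_analysis_close:
  fixes ip :: "'h::real_normed_vector \<Rightarrow> 'h \<Rightarrow> 'k::rc_field"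
  assumes F: "continuous_frame ip M F A B" and G: "continuous_frame ip M G A' B'"
    and close: "\<And>f. l2_norm M (\<lambda>s. ip f (F s) - ip f (G s)) \<le> D * norm f"
    and "0 \<le> D" and "D < sqrt A"
  shows "continuous_woven ip M F G"
  unfolding continuous_woven_def
proof (intro exI conjI ballI)
  note F = F[unfolded continuous_frame_iff_l2] and G = G[unfolded continuous_frame_iff_l2]
  show pos: "0 < (sqrt A - D)\<^sup>2" using \<open>D < sqrt A\<close> by simp
  have "(sqrt A - D)\<^sup>2 \<le> (sqrt A)\<^sup>2" using \<open>0 \<le> D\<close> \<open>D < sqrt A\<close> by (intro power_mono) auto
  then show le: "(sqrt A - D)\<^sup>2 \<le> B + B'" using F G by simp
  fix K assume K: "K \<in> sets M"
  show "continuous_frame ip M (\<lambda>s. if s \<in> K then F s else G s) ((sqrt A - D)\<^sup>2) (B + B')"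
    unfolding continuous_frame_iff_l2
  proof (intro conjI allI pos le)
    fix f
    let ?F = "\<lambda>s. ip f (F s)" and ?G = "\<lambda>s. ip f (G s)"
    let ?U = "\<lambda>s. ip f (if s \<in> K then F s else G s)"
    let ?R = "\<lambda>s. if s \<in> K then 0 else ?F s - ?G s"
    have sqF: "square_integrable M ?F" and sqG: "square_integrable M ?G"
      using F G by auto
    have intF: "integrable M (\<lambda>s. (norm (?F s))\<^sup>2)" and intG: "integrable M (\<lambda>s. (norm (?G s))\<^sup>2)"
      and [measurable]: "?F \<in> borel_measurable M" "?G \<in> borel_measurable M"
      using sqF sqG by (auto simp: square_integrable_def)
    have KM: "K \<inter> space M \<in> sets M" using K by auto
    have U: "?U = (\<lambda>s. if s \<in> K then ?F s else ?G s)" by auto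
    have mU [measurable]: "?U \<in> borel_measurable M"
      unfolding U by (intro measurable_If_set KM) measurable
    have Ule: "(norm (?U s))\<^sup>2 \<le> (norm (?F s))\<^sup>2 + (norm (?G s))\<^sup>2" for s by simp
    have intU: "integrable M (\<lambda>s. (norm (?U s))\<^sup>2)"
      by (rule Bochner_Integration.integrable_bound[OF Bochner_Integration.integrable_add[OF intF intG]])
        (use Ule in auto)
    show sqU: "square_integrable M ?U"
      using mU intU by (simp add: square_integrable_def)
    have mR: "?R \<in> borel_measurable M"
      by (intro measurable_If_set KM) measurable
    note sqR = square_integrable_mono[OF square_integrable_diff[OF sqF sqG] mR]
    have "?F = (\<lambda>s. ?U s + ?R s)" by auto
    then have "l2_norm M ?F \<le> l2_norm M ?U + l2_norm M ?R"
      using l2_Minkowski(2)[OF sqU sqR(1)] by simp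
    also have "l2_norm M ?R \<le> l2_norm M (\<lambda>s. ?F s - ?G s)"
      by (rule sqR(2)) simp
    also have "\<dots> \<le> D * norm f" by (rule close)
    finally have "l2_norm M ?F \<le> l2_norm M ?U + D * norm f" by simp
    moreover have "sqrt A * norm f \<le> l2_norm M ?F" using F by blast
    ultimately show "sqrt ((sqrt A - D)\<^sup>2) * norm f \<le> l2_norm M ?U"
      using \<open>D < sqrt A\<close> by (simp add: left_diff_distrib)
    have "(l2_norm M ?U)\<^sup>2 \<le> (\<integral>s. (norm (?F s))\<^sup>2 + (norm (?G s))\<^sup>2 \<partial>M)"
      unfolding l2_norm_power2
      by (intro integral_mono intU Bochner_Integration.integrable_add intF intG Ule)
    also have "\<dots> = (l2_norm M ?F)\<^sup>2 + (l2_norm M ?G)\<^sup>2"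
      using intF intG by (simp add: l2_norm_power2)
    also have "\<dots> \<le> (sqrt B * norm f)\<^sup>2 + (sqrt B' * norm f)\<^sup>2"
      using F G by (intro add_mono power_mono) auto
    also have "\<dots> = (sqrt (B + B') * norm f)\<^sup>2"
      using F G by (simp add: power_mult_distrib distrib_right)
    finally show "l2_norm M ?U \<le> sqrt (B + B') * norm f"
      by (rule power2_le_imp_le) (use F G in simp)
  qed
qed

theorem theorem3p9:
  fixes scale :: "'k::rc_field \<Rightarrow> 'h::{banach, second_countable_topology} \<Rightarrow> 'h"
    and ip :: "'h \<Rightarrow> 'h \<Rightarrow> 'k"
    and M :: "'s measure"
    and F G :: "'s \<Rightarrow> 'h"
    and A\<^sub>F B\<^sub>F A\<^sub>G B\<^sub>G a b c :: real
  assumes "separable_hilbert_space scale ip"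
    and "continuous_frame ip M F A\<^sub>F B\<^sub>F"
    and "continuous_frame ip M G A\<^sub>G B\<^sub>G"
    and "0 < a" and "0 < b" and "0 < c"
    and "\<And>\<alpha> :: 's \<Rightarrow> 'k. square_integrable M \<alpha> \<Longrightarrow>
           norm (weak_integral ip M (\<lambda>s. scale (\<alpha> s) (F s - G s)))
             \<le> a * norm (weak_integral ip M (\<lambda>s. scale (\<alpha> s) (F s)))
               + b * norm (weak_integral ip M (\<lambda>s. scale (\<alpha> s) (G s)))
               + c * sqrt (\<integral>s. (norm (\<alpha> s))\<^sup>2 \<partial>M)"
    and "a * sqrt B\<^sub>F + b * sqrt B\<^sub>G + c < sqrt A\<^sub>F"
  shows "continuous_woven ip M F G"
proof -
  interpret separable_hilbert_space scale ip by fact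
  note F = assms(2)[unfolded continuous_frame_iff_l2]
    and G = assms(3)[unfolded continuous_frame_iff_l2]
  define D where "D = a * sqrt B\<^sub>F + b * sqrt B\<^sub>G + c"
  have D: "0 \<le> D" using F G assms(4-6) by (simp add: D_def)
  have "l2_norm M (\<lambda>s. ip f (F s) - ip f (G s)) \<le> D * norm f" for f
  proof -
    define \<alpha> where "\<alpha> = (\<lambda>s. ip f (F s - G s))"
    have \<alpha>: "square_integrable M \<alpha>"
      unfolding \<alpha>_def ip_diff_right using F G by (intro square_integrable_diff) auto
    let ?v = "weak_integral ip M (\<lambda>s. scale (\<alpha> s) (F s))"
    let ?w = "weak_integral ip M (\<lambda>s. scale (\<alpha> s) (G s))"
    have v: "has_weak_integral ip M (\<lambda>s. scale (\<alpha> s) (F s)) ?v" "norm ?v \<le> sqrt B\<^sub>F * l2_norm M \<alpha>"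
      using weak_integral_synthesis[of M F "sqrt B\<^sub>F" \<alpha>] F \<alpha> by auto
    have w: "has_weak_integral ip M (\<lambda>s. scale (\<alpha> s) (G s)) ?w" "norm ?w \<le> sqrt B\<^sub>G * l2_norm M \<alpha>"
      using weak_integral_synthesis[of M G "sqrt B\<^sub>G" \<alpha>] G \<alpha> by auto
    have vw: "has_weak_integral ip M (\<lambda>s. scale (\<alpha> s) (F s - G s)) (?v - ?w)"
      using has_weak_integral_diff[OF v(1) w(1)] by (simp add: scale_right_diff_distrib)
    have "norm (?v - ?w) \<le> a * norm ?v + b * norm ?w + c * l2_norm M \<alpha>"
      using assms(7)[OF \<alpha>] by (simp add: weak_integral_eqI[OF vw] l2_norm_def)
    also have "\<dots> \<le> a * (sqrt B\<^sub>F * l2_norm M \<alpha>) + b * (sqrt B\<^sub>G * l2_norm M \<alpha>) + c * l2_norm M \<alpha>"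
      using assms(4,5) by (intro add_mono mult_left_mono v w order_refl) auto
    finally have "norm (?v - ?w) \<le> D * l2_norm M \<alpha>"
      by (simp add: D_def algebra_simps)
    then show ?thesis
      using l2_norm_analysis_le[of M f "\<lambda>s. F s - G s" "?v - ?w" D] \<alpha> vw D
      by (simp add: \<alpha>_def ip_diff_right)
  qed
  moreover have "D < sqrt A\<^sub>F" using assms(8) by (simp add: D_def)
  ultimately show ?thesis
    using continuous_woven_of_analysis_close[OF assms(2,3)] D by blast
qed

end
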